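(* Let $n\ge2$. Let $\widehat F\colon\mathbb{R}\times\mathbb{S}^{n-1}\to\mathbb{R}^{2n}$ be the map $(t,p)\mapsto f(t)\,\iota(p)$, where $\iota\colon\mathbb{R}^n\to\mathbb{C}^n$ is the embedding $p\mapsto(p,0)$ and $f\colon\mathbb{R}\to\mathbb{C}$ is the function $t\mapsto(\sinh nt-i)^{1/n}$. Then the map $$F=\widehat F\circ\varphi\colon\mathbb{R}^n\setminus\{0\}\to\mathbb{R}^{2n},$$ where $\varphi\colon\mathbb{R}^n\setminus\{0\}\to\mathbb{R}\times\mathbb{S}^{n-1}$ is the map $x\mapsto\left(\log|x|,\frac{x}{|x|}\right)$, is a conformal $\omega_{\mathrm{SL}}$-curve onto the Lagrangian catenoid $\mathcal{M}_{\mathrm{SL}}$.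
   Context: $\mathbb{C}^n$ is identified with $\mathbb{R}^n\times\mathbb{R}^n=\mathbb{R}^{2n}$ via $z_j=x_j+iy_j$, $z\leftrightarrow(x,y)$. The Special Lagrangian calibration is $\omega_{\mathrm{SL}}=\mathrm{Re}(dz_1\wedge\cdots\wedge dz_n)\in\Lambda^n\mathbb{R}^{2n}$. The Lagrangian catenoid is $$\mathcal{M}_{\mathrm{SL}}=\Big\{(x,y)\in\mathbb{R}^{2n}:\ |x|y=|y|x,\ \mathrm{Im}\big((|x|+i|y|)^n\big)=1,\ |y|<|x|\tan(\pi/n)\Big\}.$$ For a calibration $\omega\in\Lambda^n\mathbb{R}^m$ (i.e. $\sup\{\omega(v_1,\dots,v_n):|v_1|=\cdots=|v_n|=1\}=1$), $\mathrm{SO}(\omega)$ is the set of linear isometries $O\colon\mathbb{R}^n\to\mathbb{R}^m$ with $O^*\omega=\mathrm{vol}_{\mathbb{R}^n}$, $\mathrm{CO}(\omega)=\{\lambda O:O\in\mathrm{SO}(\omega),\lambda\ge0\}$, and a map $F\in W^{1,n}_{\mathrm{loc}}(\Omega,\mathbb{R}^m)$, $\Omega\subset\mathbb{R}^n$ open, is a conformal $\omega$-curve if $(DF)_x\in\mathrm{CO}(\omega)$ for almost every $x\in\Omega$.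
   Formalization: The sign in f is corrected to f(t) = (sinh nt + i)^{1/n} (principal root); with the printed −i, F is shown to be a conformal ω_SL-curve onto the complex conjugate of M_SL, not M_SL itself. For n = 2 the bound |y| < |x| tan(π/n) is read as void. *)

theory Defs
  imports "HOL-Analysis.Analysis"
begin

text \<open>
  An \<open>n\<close>-covector on a Euclidean space \<open>'b\<close> is a function of \<open>n\<close> vectors indexed by the finite
  type \<open>'n\<close>, and \<open>n = CARD('n)\<close>.  Coordinates of \<open>real^'n\<close> and arguments of covectors share the
  index type, so no ordering of \<open>'n\<close> has to be chosen.  Complex \<open>n\<close>-space is
  \<open>(real^'n) \<times> (real^'n)\<close>, where \<open>(x, y)\<close> stands for \<open>x + \<i> y\<close>.
\<close>

type_synonym ('b, 'n) covector = "('n \<Rightarrow> 'b) \<Rightarrow> real"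

definition vol :: "(real^'n, 'n::finite) covector" where
  "vol v = det (\<chi> i. v i)"

definition SO_form :: "('b::euclidean_space, 'n::finite) covector \<Rightarrow> (real^'n \<Rightarrow> 'b) set" where
  "SO_form \<omega> = {T. linear T \<and> (\<forall>v. norm (T v) = norm v) \<and>
                   (\<forall>v. \<omega> (\<lambda>i. T (v i)) = vol v)}"

definition CO_form :: "('b::euclidean_space, 'n::finite) covector \<Rightarrow> (real^'n \<Rightarrow> 'b) set" where
  "CO_form \<omega> = {\<lambda>v. c *\<^sub>R T v | c T. T \<in> SO_form \<omega> \<and> c \<ge> 0}"

primrec times_cont_diff :: "nat \<Rightarrow> ('a::euclidean_space \<Rightarrow> real) \<Rightarrow> bool" where
  "times_cont_diff 0 g \<longleftrightarrow> continuous_on UNIV g"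
| "times_cont_diff (Suc k) g \<longleftrightarrow>
     (\<forall>x. g differentiable (at x)) \<and>
     (\<forall>b\<in>Basis. times_cont_diff k (\<lambda>x. frechet_derivative g (at x) b))"

definition test_functions :: "'a::euclidean_space set \<Rightarrow> ('a \<Rightarrow> real) set" where
  "test_functions \<Omega> = {g. (\<forall>k. times_cont_diff k g) \<and>
                          compact (closure {x. g x \<noteq> 0}) \<and> closure {x. g x \<noteq> 0} \<subseteq> \<Omega>}"

definition Lp_loc :: "nat \<Rightarrow> 'a::euclidean_space set \<Rightarrow> ('a \<Rightarrow> 'b::euclidean_space) set" where
  "Lp_loc p \<Omega> = {F. F \<in> borel_measurable (lebesgue_on \<Omega>) \<and>
                    (\<forall>K. compact K \<and> K \<subseteq> \<Omega> \<longrightarrow> set_integrable lebesgue K (\<lambda>x. norm (F x) ^ p))}"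

definition has_weak_derivative_on ::
  "('a::euclidean_space \<Rightarrow> 'b::euclidean_space) \<Rightarrow> ('a \<Rightarrow> 'a \<Rightarrow> 'b) \<Rightarrow> 'a set \<Rightarrow> bool" where
  "has_weak_derivative_on F D \<Omega> \<longleftrightarrow>
     (\<forall>x\<in>\<Omega>. linear (D x)) \<and>
     (\<forall>g\<in>test_functions \<Omega>. \<forall>b\<in>Basis.
        (LINT x:\<Omega>|lebesgue. frechet_derivative g (at x) b *\<^sub>R F x) =
        - (LINT x:\<Omega>|lebesgue. g x *\<^sub>R D x b))"

text \<open>\<open>F\<close> belongs to \<open>W\<^sup>1\<^sup>,\<^sup>p\<close> locally on \<open>\<Omega>\<close>, with weak derivative \<open>D\<close>.\<close>

definition has_sobolev_derivative_on ::
  "nat \<Rightarrow> ('a::euclidean_space \<Rightarrow> 'b::euclidean_space) \<Rightarrow> ('a \<Rightarrow> 'a \<Rightarrow> 'b) \<Rightarrow> 'a set \<Rightarrow> bool" where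
  "has_sobolev_derivative_on p F D \<Omega> \<longleftrightarrow>
     F \<in> Lp_loc p \<Omega> \<and> (\<forall>b\<in>Basis. (\<lambda>x. D x b) \<in> Lp_loc p \<Omega>) \<and> has_weak_derivative_on F D \<Omega>"

text \<open>Weak derivatives are unique almost everywhere, so the choice of \<open>D\<close> is immaterial.\<close>

definition conformal_curve ::
  "('b::euclidean_space, 'n::finite) covector \<Rightarrow> (real^'n) set \<Rightarrow> (real^'n \<Rightarrow> 'b) \<Rightarrow> bool" where
  "conformal_curve \<omega> \<Omega> F \<longleftrightarrow>
     open \<Omega> \<and>
     (\<exists>D. has_sobolev_derivative_on CARD('n) F D \<Omega> \<and>
          (AE x in lebesgue_on \<Omega>. D x \<in> CO_form \<omega>))"

definition dz :: "'n \<Rightarrow> (real^'n) \<times> (real^'n) \<Rightarrow> complex" where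
  "dz j v = Complex (fst v $ j) (snd v $ j)"

definition omega_SL :: "((real^'n) \<times> (real^'n), 'n::finite) covector" where
  "omega_SL v = Re (det (\<chi> i j. dz j (v i)))"

text \<open>
  For \<open>n = 2\<close> the bound \<open>|y| < |x| tan (\<pi> / n)\<close> is void, as \<open>tan (\<pi> / 2) = \<infinity>\<close> (and \<open>x \<noteq> 0\<close> holds by
  the preceding equation), whereas in HOL \<open>tan (pi / 2) = 0\<close>.
\<close>

definition catenoid_SL :: "((real^'n::finite) \<times> (real^'n)) set" where
  "catenoid_SL = {(x, y).
     norm x *\<^sub>R y = norm y *\<^sub>R x \<and>
     Im (Complex (norm x) (norm y) ^ CARD('n)) = 1 \<and>
     (CARD('n) > 2 \<longrightarrow> norm y < norm x * tan (pi / real CARD('n)))}"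

definition cscale :: "complex \<Rightarrow> (real^'n) \<times> (real^'n) \<Rightarrow> (real^'n) \<times> (real^'n)" where
  "cscale a z = (Re a *\<^sub>R fst z - Im a *\<^sub>R snd z, Re a *\<^sub>R snd z + Im a *\<^sub>R fst z)"

definition iota :: "real^'n \<Rightarrow> (real^'n) \<times> (real^'n)" where
  "iota p = (p, 0)"

definition conj_vec :: "(real^'n) \<times> (real^'n) \<Rightarrow> (real^'n) \<times> (real^'n)" where
  "conj_vec z = (fst z, - snd z)"

text \<open>
  The function \<open>t \<mapsto> (sinh (n t) + c)\<^bsup>1/n\<^esup>\<close> (principal branch) is used for \<open>c = \<i>\<close> and \<open>c = - \<i>\<close>.
  Its \<open>n\<close>-th power has imaginary part \<open>Im c\<close>, while \<open>Im ((|x| + \<i> |y|)\<^sup>n) = 1\<close> on the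
  catenoid: \<open>c = \<i>\<close> parametrises the catenoid itself and \<open>c = - \<i>\<close> its complex conjugate.
\<close>

definition profile :: "nat \<Rightarrow> complex \<Rightarrow> real \<Rightarrow> complex" where
  "profile n c t = (complex_of_real (sinh (real n * t)) + c) powr (1 / of_nat n)"

definition cylinder_map :: "complex \<Rightarrow> real \<times> (real^'n::finite) \<Rightarrow> (real^'n) \<times> (real^'n)" where
  "cylinder_map c = (\<lambda>(t, p). cscale (profile CARD('n) c t) (iota p))"

definition log_polar :: "real^'n::finite \<Rightarrow> real \<times> (real^'n)" where
  "log_polar x = (ln (norm x), x /\<^sub>R norm x)"

definition catenoid_map :: "complex \<Rightarrow> real^'n::finite \<Rightarrow> (real^'n) \<times> (real^'n)" where
  "catenoid_map c = cylinder_map c \<circ> log_polar"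

end

theory Submission
  imports Defs
begin

text \<open>
  With \<open>u = x / |x|\<close>, \<open>t = ln |x|\<close> and \<open>f = profile n c\<close>, the derivative at \<open>x\<close> multiplies the radial direction by
  \<open>f' t / |x|\<close> and the directions orthogonal to \<open>u\<close> by \<open>f t / |x|\<close>.  Since \<open>f' = f cosh (n t) / (sinh (n t) + c)\<close>
  and \<open>|sinh (n t) + c| = cosh (n t)\<close> for \<open>c = \<plusminus>\<i>\<close>, both factors have the same modulus, and the complex
  determinant \<open>f' f\<^bsup>n - 1\<^esup> / |x|\<^bsup>n\<^esup> = cosh (n t) / |x|\<^bsup>n\<^esup>\<close> is real and positive; hence the derivative is conformal
  and calibrated.  The map is smooth off the origin, so its classical derivative is the weak one.  For the image,
  \<open>n\<close>-th powers map the sector \<open>0 < arg w < \<pi> / n\<close> bijectively onto the upper half plane, and \<open>sinh\<close> maps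
  onto the reals.
\<close>

section \<open>Integrals of derivatives of compactly supported functions\<close>

lemma integral_lborel_translation:
  fixes f :: "'a::euclidean_space \<Rightarrow> 'b::euclidean_space"
  assumes "f \<in> borel_measurable borel"
  shows "(LINT x|lborel. f (x + c)) = (LINT x|lborel. f x)"
proof -
  have "(LINT x|lborel. f x) = (LINT x|distr lborel borel ((+) c). f x)"
    by (simp only: lborel_distr_plus)
  also have "\<dots> = (LINT x|lborel. f (c + x))"
    using assms by (intro integral_distr) auto
  finally show ?thesis
    by (simp add: add.commute)
qed

lemma integrable_continuous_compact_support:
  fixes f :: "'a::euclidean_space \<Rightarrow> 'b::euclidean_space"
  assumes "continuous_on UNIV f" "compact K" "\<And>x. x \<notin> K \<Longrightarrow> f x = 0"
  shows "integrable lborel f"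
proof -
  have "integrable lborel (\<lambda>x. indicator K x *\<^sub>R f x)"
    using assms by (intro borel_integrable_compact) (auto intro: continuous_on_subset)
  also have "(\<lambda>x. indicator K x *\<^sub>R f x) = f"
    using assms(3) by (auto simp: indicator_def)
  finally show ?thesis .
qed

text \<open>Mean value inequality along the line through \<open>x\<close> in direction
  \<open>b\<close>, where only the derivative in that direction has to be bounded. It supplies a
  bound on difference quotients that is uniform in the step, as dominated convergence
  requires.\<close>

lemma directional_mean_value_bound:
  fixes h :: "'a::real_normed_vector \<Rightarrow> 'b::real_normed_vector"
  assumes "\<And>x. (h has_derivative D x) (at x)"
    and "\<And>x. norm (D x b) \<le> M"
  shows "norm (h (x + t *\<^sub>R b) - h x) \<le> M * \<bar>t\<bar>"
proof -
  have lin: "D y (s *\<^sub>R b) = s *\<^sub>R D y b" for y s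
    using has_derivative_linear[OF assms(1)] by (simp add: linear_cmul)
  have der: "((\<lambda>s. h (x + s *\<^sub>R b)) has_derivative (\<lambda>s. s *\<^sub>R D (x + s' *\<^sub>R b) b)) (at s' within UNIV)" for s'
    by (rule has_derivative_compose[of "\<lambda>s. x + s *\<^sub>R b" "\<lambda>s. s *\<^sub>R b" s' UNIV, OF _ assms(1), unfolded lin])
       (auto intro!: derivative_eq_intros)
  have "norm (h (x + t *\<^sub>R b) - h (x + 0 *\<^sub>R b)) \<le> M * norm (t - 0)"
  proof (rule differentiable_bound[OF convex_UNIV der])
    show "onorm (\<lambda>r. r *\<^sub>R D (x + s *\<^sub>R b) b) \<le> M" for s
      using assms(2) by (intro onorm_le) (auto simp: mult.commute[of M] intro: mult_left_mono)
  qed auto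
  then show ?thesis by simp
qed

text \<open>The integral of \<open>h\<close> is invariant under translation by \<open>t b\<close>; differentiate at \<open>t = 0\<close>.\<close>

lemma integral_directional_derivative_eq_0:
  fixes h :: "'a::euclidean_space \<Rightarrow> 'b::euclidean_space"
  assumes h: "\<And>x. (h has_derivative D x) (at x)"
    and cont: "continuous_on UNIV (\<lambda>x. D x b)"
    and K: "compact K" "\<And>x. x \<notin> K \<Longrightarrow> h x = 0"
  shows "(LINT x|lborel. D x b) = 0"
proof -
  have hcont: "continuous_on UNIV h"
    using h by (meson continuous_at_imp_continuous_on has_derivative_continuous)
  have hmeas [measurable]: "h \<in> borel_measurable borel"
    using hcont by (rule borel_measurable_continuous_onI)
  have lin: "D y (s *\<^sub>R b) = s *\<^sub>R D y b" for y s
    using has_derivative_linear[OF h] by (simp add: linear_cmul)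
  have D0: "D x b = 0" if "x \<notin> K" for x
  proof -
    have "open (- K)" using K(1) by (simp add: compact_imp_closed open_Compl)
    then have "((\<lambda>_. 0) has_derivative D x) (at x)"
      using h[of x] that K(2) by (intro has_derivative_transform_within_open[OF h, of "- K"]) auto
    then have "D x = (\<lambda>_. 0)"
      by (rule has_derivative_unique) simp
    then show ?thesis by simp
  qed
  have "compact ((\<lambda>x. norm (D x b)) ` K)"
    using cont K(1) by (intro compact_continuous_image continuous_intros) (auto intro: continuous_on_subset)
  then obtain M0 where M0: "\<forall>x\<in>K. norm (D x b) \<le> M0"
    by (auto dest!: compact_imp_bounded simp: bounded_iff)
  \<comment> \<open>Off \<open>K\<close> the derivative is zero, so a bound valid everywhere must be
    nonnegative; \<open>M0\<close> may be negative if \<open>K\<close> is empty.\<close>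
  define M where "M = max M0 0"
  have M: "norm (D x b) \<le> M" for x
    using M0 D0[of x] by (cases "x \<in> K") (auto simp: M_def intro: order_trans[OF _ max.cobounded1])
  \<comment> \<open>The set swept out by \<open>K\<close> under backward translations of length at
    most one. It contains the supports of all difference quotients below, so \<open>M\<close> times
    its indicator is an integrable majorant.\<close>
  define K' where "K' = (\<lambda>(x, s). x - s *\<^sub>R b) ` (K \<times> {0..1})"
  have K': "compact K'"
    unfolding K'_def using K(1)
    by (intro compact_continuous_image compact_Times) (auto intro!: continuous_intros simp: case_prod_unfold)
  \<comment> \<open>Difference quotients with step \<open>1 / (n + 1)\<close>; the shift by one
    keeps every step nonzero and within \<open>{0..1}\<close>.\<close>
  define s where "s n x = real (Suc n) *\<^sub>R (h (x + inverse (real (Suc n)) *\<^sub>R b) - h x)" for n x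
  have hint: "integrable lborel h"
    by (rule integrable_continuous_compact_support[OF hcont K])
  have s0: "integral\<^sup>L lborel (s n) = 0" for n
  proof -
    have "integrable lborel (\<lambda>x. h (x + inverse (real (Suc n)) *\<^sub>R b))"
    proof (rule integrable_continuous_compact_support)
      show "continuous_on UNIV (\<lambda>x. h (x + inverse (real (Suc n)) *\<^sub>R b))"
        by (rule continuous_on_compose2[OF hcont]) (auto intro!: continuous_intros)
      show "compact ((\<lambda>x. x - inverse (real (Suc n)) *\<^sub>R b) ` K)"
        using K(1) by (intro compact_continuous_image continuous_intros) auto
      show "h (x + inverse (real (Suc n)) *\<^sub>R b) = 0"
        if "x \<notin> (\<lambda>x. x - inverse (real (Suc n)) *\<^sub>R b) ` K" for x
        using that by (intro K(2)) (auto simp: image_iff)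
    qed
    then show ?thesis
      unfolding s_def using hint integral_lborel_translation[OF hmeas, of "inverse (real (Suc n)) *\<^sub>R b"]
      by (simp del: of_nat_Suc)
  qed
  have "(\<lambda>n. integral\<^sup>L lborel (s n)) \<longlonglongrightarrow> (LINT x|lborel. D x b)"
  proof (rule integral_dominated_convergence[where w = "\<lambda>x. indicator K' x *\<^sub>R M"])
    show "(\<lambda>x. D x b) \<in> borel_measurable lborel"
      using cont by (simp add: borel_measurable_continuous_onI)
    show "s n \<in> borel_measurable lborel" for n
      unfolding s_def by measurable
    show "integrable lborel (\<lambda>x. indicator K' x *\<^sub>R M)"
      using K' by (intro borel_integrable_compact) auto
    show "AE x in lborel. (\<lambda>n. s n x) \<longlonglongrightarrow> D x b"
    proof (rule AE_I2)
      fix x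
      have "((\<lambda>t. h (x + t *\<^sub>R b)) has_derivative (\<lambda>t. t *\<^sub>R D (x + 0 *\<^sub>R b) b)) (at 0)"
        by (rule has_derivative_compose[of "\<lambda>s. x + s *\<^sub>R b" "\<lambda>s. s *\<^sub>R b" 0 UNIV, OF _ h, unfolded lin])
           (auto intro!: derivative_eq_intros)
      then have "((\<lambda>t. norm (h (x + t *\<^sub>R b) - h x - t *\<^sub>R D x b) / norm t) \<longlongrightarrow> 0) (at 0)"
        by (simp add: has_derivative_iff_norm)
      moreover have "filterlim (\<lambda>n. inverse (real (Suc n))) (at 0) sequentially"
        by (intro filterlim_atI LIMSEQ_inverse_real_of_nat) auto
      ultimately have "(\<lambda>n. norm (h (x + inverse (real (Suc n)) *\<^sub>R b) - h x - inverse (real (Suc n)) *\<^sub>R D x b)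
          / norm (inverse (real (Suc n)))) \<longlonglongrightarrow> 0"
        by (rule filterlim_compose)
      also have "(\<lambda>n. norm (h (x + inverse (real (Suc n)) *\<^sub>R b) - h x - inverse (real (Suc n)) *\<^sub>R D x b)
          / norm (inverse (real (Suc n)))) = (\<lambda>n. norm (s n x - D x b))"
      proof
        fix n
        have eq: "s n x - D x b = real (Suc n) *\<^sub>R
            (h (x + inverse (real (Suc n)) *\<^sub>R b) - h x - inverse (real (Suc n)) *\<^sub>R D x b)"
          unfolding s_def by (simp add: scaleR_diff_right del: of_nat_Suc)
        show "norm (h (x + inverse (real (Suc n)) *\<^sub>R b) - h x - inverse (real (Suc n)) *\<^sub>R D x b)
          / norm (inverse (real (Suc n))) = norm (s n x - D x b)"
          unfolding eq norm_scaleR by (simp add: divide_inverse del: of_nat_Suc)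
      qed
      finally show "(\<lambda>n. s n x) \<longlonglongrightarrow> D x b"
        by (rule LIM_zero_cancel[OF tendsto_norm_zero_cancel])
    qed
    show "AE x in lborel. norm (s n x) \<le> indicator K' x *\<^sub>R M" for n
    proof (rule AE_I2)
      fix x
      let ?t = "inverse (real (Suc n))"
      show "norm (s n x) \<le> indicator K' x *\<^sub>R M"
      proof (cases "x \<in> K'")
        case True
        have "norm (s n x) = real (Suc n) * norm (h (x + ?t *\<^sub>R b) - h x)"
          by (simp add: s_def del: of_nat_Suc)
        also have "\<dots> \<le> real (Suc n) * (M * \<bar>?t\<bar>)"
          by (intro mult_left_mono directional_mean_value_bound[OF h M]) auto
        also have "\<dots> = M" by (simp add: field_simps)
        finally show ?thesis using True by simp
      next
        case False
        have "x + t *\<^sub>R b \<notin> K" if "t \<in> {0..1}" for t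
        proof
          assume "x + t *\<^sub>R b \<in> K"
          then have "(\<lambda>(x, s). x - s *\<^sub>R b) (x + t *\<^sub>R b, t) \<in> K'"
            unfolding K'_def using that by (intro imageI) auto
          then show False using False by simp
        qed
        from this[of 0] this[of ?t] have "h x = 0" "h (x + ?t *\<^sub>R b) = 0"
          using K(2) by (auto simp: inverse_le_1_iff)
        then show ?thesis by (simp add: s_def False)
      qed
    qed
  qed
  then show ?thesis
    by (simp add: s0 LIMSEQ_const_iff)
qed

section \<open>Complex determinants and radial stretches\<close>

lemma det_of_real:
  fixes A :: "real^'n^'n"
  shows "det (\<chi> i j. complex_of_real (A $ i $ j)) = of_real (det A)"
  by (simp add: det_def)

text \<open>In an orthonormal basis starting with \<open>u\<close> the matrix
  \<open>a u u^T + b I\<close> is diagonal, with eigenvalue \<open>a + b\<close> once and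
  \<open>b\<close> in all remaining directions.\<close>

lemma det_rank_one_update:
  fixes u :: "real^'n" and a b :: complex
  assumes "norm u = 1"
  shows "det (\<chi> i j. a * of_real (u $ i * u $ j) + (if i = j then b else 0)) = (a + b) * b ^ (CARD('n) - 1)"
proof -
  \<comment> \<open>An arbitrary index: the column of \<open>Q\<close> that is to equal
    \<open>u\<close>.\<close>
  obtain k :: 'n where True by simp
  obtain Q where Q: "orthogonal_matrix Q" "Q *v axis k 1 = u"
    using orthogonal_matrix_exists_basis[OF assms] by metis
  have u: "u $ i = Q $ i $ k" for i
    using Q(2) by (auto simp: matrix_vector_mul_component inner_axis)
  have QQ: "(\<Sum>l\<in>UNIV. Q $ i $ l * Q $ j $ l) = (if i = j then 1 else 0)" for i j
    using Q(1) by (auto simp: orthogonal_matrix_def matrix_matrix_mult_def transpose_def mat_def vec_eq_iff)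
  define P where "P = (\<chi> i j. complex_of_real (Q $ i $ j))"
  define E where "E = (\<chi> i j. if i = j then (if i = k then a + b else b) else (0 :: complex))"
  have cQQ: "(\<Sum>l\<in>UNIV. complex_of_real (Q $ i $ l) * of_real (Q $ j $ l)) = (if i = j then 1 else 0)" for i j
    using arg_cong[OF QQ[of i j], of complex_of_real] by (simp split: if_splits)
  have PP: "P ** transpose P = mat 1"
    by (simp add: P_def matrix_matrix_mult_def transpose_def mat_def vec_eq_iff cQQ)
  have PE: "(P ** E) $ i $ l = P $ i $ l * (if l = k then a + b else b)" for i l
    by (simp add: matrix_matrix_mult_def E_def mult_delta_right)
  have "(P ** E ** transpose P) $ i $ j =
      (\<Sum>l\<in>UNIV. b * (P $ i $ l * P $ j $ l) + (if l = k then a * (P $ i $ k * P $ j $ k) else 0))" for i j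
    by (subst matrix_matrix_mult_def) (auto simp: PE transpose_def algebra_simps intro!: sum.cong)
  then have "(\<chi> i j. a * of_real (u $ i * u $ j) + (if i = j then b else 0)) = P ** E ** transpose P"
    by (auto simp: vec_eq_iff sum.distrib sum_distrib_left[symmetric] u P_def cQQ)
  \<comment> \<open>The outer two determinants are recombined, so that
    \<open>P ** transpose P = mat 1\<close> removes them together.\<close>
  then have "det (\<chi> i j. a * of_real (u $ i * u $ j) + (if i = j then b else 0)) = det (P ** transpose P) * det E"
    by (simp add: det_mul)
  also have "\<dots> = (\<Prod>i\<in>UNIV. if i = k then a + b else b)"
    by (simp only: PP) (subst det_diagonal, auto simp: E_def)
  also have "\<dots> = (a + b) * (\<Prod>i\<in>UNIV - {k}. b)"
    by (subst prod.remove[of _ k]) auto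
  finally show ?thesis by simp
qed

text \<open>For a unit vector \<open>u\<close> this multiplies the direction \<open>u\<close> by
  \<open>a + b\<close> and its orthogonal complement by \<open>b\<close>. Derivatives of maps
  \<open>x \<mapsto> q(|x|) x\<close> with complex \<open>q\<close> have this form.\<close>

definition radial_stretch :: "complex \<Rightarrow> complex \<Rightarrow> real^'n \<Rightarrow> real^'n \<Rightarrow> (real^'n) \<times> (real^'n)" where
  "radial_stretch a b u v = cscale (a * of_real (u \<bullet> v)) (iota u) + cscale b (iota v)"

lemma linear_radial_stretch: "linear (radial_stretch a b u)"
  by (rule linearI) (auto simp: radial_stretch_def cscale_def iota_def algebra_simps inner_add_right)

lemma scale_radial_stretch:
  "c *\<^sub>R radial_stretch a b u v = radial_stretch (of_real c * a) (of_real c * b) u v"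
  by (simp add: radial_stretch_def cscale_def iota_def algebra_simps)

text \<open>The parts of \<open>v\<close> along \<open>u\<close> and orthogonal to \<open>u\<close>
  are multiplied by complex numbers of equal modulus, and their images stay orthogonal.\<close>

lemma norm_radial_stretch:
  assumes "norm u = 1" "cmod (a + b) = cmod b"
  shows "norm (radial_stretch a b u v) = cmod b * norm v"
proof -
  let ?s = "u \<bullet> v"
  have u: "u \<bullet> u = 1" using assms(1) by (simp add: norm_eq_1)
  have *: "(Re a + Re b)\<^sup>2 + (Im a + Im b)\<^sup>2 = (Re b)\<^sup>2 + (Im b)\<^sup>2"
    using arg_cong[OF assms(2), of "\<lambda>x. x\<^sup>2"] by (simp add: cmod_power2)
  have "(norm (radial_stretch a b u v))\<^sup>2 = 
    (Re a * ?s)\<^sup>2 + 2 * Re a * Re b * ?s\<^sup>2 + (Re b)\<^sup>2 * (v \<bullet> v) +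
    ((Im a * ?s)\<^sup>2 + 2 * Im a * Im b * ?s\<^sup>2 + (Im b)\<^sup>2 * (v \<bullet> v))"
    using u by (simp only: power2_norm_eq_inner) (simp add: radial_stretch_def inner_Pair cscale_def iota_def
        inner_add_left inner_add_right inner_commute[of v u] power2_eq_square algebra_simps)
  \<comment> \<open>The coefficient of \<open>?s\<^sup>2\<close> is collected as
    \<open>|a + b|^2 - |b|^2\<close>, which vanishes.\<close>
  also have "\<dots> = ((Re a + Re b)\<^sup>2 + (Im a + Im b)\<^sup>2 - ((Re b)\<^sup>2 + (Im b)\<^sup>2)) * ?s\<^sup>2 + ((Re b)\<^sup>2 + (Im b)\<^sup>2) * (v \<bullet> v)"
    by algebra
  also have "\<dots> = (cmod b * norm v)\<^sup>2"
    unfolding * by (simp add: cmod_power2 power_mult_distrib power2_norm_eq_inner)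
  finally show ?thesis by (simp add: power2_eq_iff_nonneg)
qed

text \<open>The matrix of the \<open>dz j\<close> on the images factors as the real matrix with rows
  \<open>v i\<close> times the symmetric matrix \<open>a u u^T + b I\<close>, so the determinant
  splits.\<close>

lemma omega_SL_radial_stretch:
  fixes u :: "real^'n"
  assumes "norm u = 1"
  shows "omega_SL (\<lambda>i. radial_stretch a b u (v i)) = Re ((a + b) * b ^ (CARD('n) - 1)) * vol v"
proof -
  let ?N = "\<chi> i j. a * of_real (u $ i * u $ j) + (if i = j then b else 0)"
  let ?V = "\<chi> i j. complex_of_real ((\<chi> i. v i) $ i $ j)"
  have "(\<chi> i j. dz j (radial_stretch a b u (v i))) = ?V ** ?N"
  proof -
    have "dz j (radial_stretch a b u (v i)) = a * (of_real (u \<bullet> v i) * of_real (u $ j)) + b * of_real (v i $ j)" for i j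
      by (simp add: dz_def radial_stretch_def cscale_def iota_def complex_eq_iff)
    moreover have "(?V ** ?N) $ i $ j = a * (of_real (u \<bullet> v i) * of_real (u $ j)) + b * of_real (v i $ j)" for i j
    proof -
      have "(?V ** ?N) $ i $ j = (\<Sum>k\<in>UNIV. a * (of_real (u $ k * v i $ k) * of_real (u $ j)) +
          (if k = j then b * of_real (v i $ j) else 0))"
        by (auto simp: matrix_matrix_mult_def algebra_simps intro!: sum.cong)
      then show ?thesis
        by (simp add: inner_vec_def sum.distrib sum_distrib_left sum_distrib_right)
    qed
    ultimately show ?thesis by (simp add: vec_eq_iff)
  qed
  then have "det (\<chi> i j. dz j (radial_stretch a b u (v i))) = of_real (vol v) * ((a + b) * b ^ (CARD('n) - 1))"
    by (simp only: det_mul det_of_real det_rank_one_update[OF assms] vol_def)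
  then show ?thesis by (simp add: omega_SL_def)
qed

text \<open>Division by \<open>cmod b\<close> turns the map into an isometry, and the last
  hypothesis says that its complex determinant then becomes 1.\<close>

lemma radial_stretch_in_CO:
  fixes u :: "real^'n"
  assumes "norm u = 1" "b \<noteq> 0" "cmod (a + b) = cmod b"
    and "(a + b) * b ^ (CARD('n) - 1) = of_real (cmod b ^ CARD('n))"
  shows "radial_stretch a b u \<in> CO_form omega_SL"
proof -
  let ?r = "of_real (inverse (cmod b)) :: complex"
  let ?T = "radial_stretch (?r * a) (?r * b) u"
  have r: "cmod b > 0" using assms(2) by simp
  have "norm (?T v) = norm v" for v
    using assms(1-3) by (subst norm_radial_stretch) (auto simp: norm_mult norm_inverse simp flip: distrib_left)
  moreover have "omega_SL (\<lambda>i. ?T (v i)) = vol v" for v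
  proof -
    have "(?r * a + ?r * b) * (?r * b) ^ m = ?r ^ Suc m * ((a + b) * b ^ m)" for m
      by (simp add: power_mult_distrib algebra_simps)
    then have "(?r * a + ?r * b) * (?r * b) ^ (CARD('n) - 1) = ?r ^ Suc (CARD('n) - 1) * ((a + b) * b ^ (CARD('n) - 1))" .
    also have "Suc (CARD('n) - 1) = CARD('n)" by simp
    also have "?r ^ CARD('n) * ((a + b) * b ^ (CARD('n) - 1)) = 1"
      using r unfolding assms(4) by (simp flip: power_mult_distrib)
    finally show ?thesis
      by (simp add: omega_SL_radial_stretch[OF assms(1)])
  qed
  ultimately have "?T \<in> SO_form omega_SL"
    by (simp add: SO_form_def linear_radial_stretch)
  moreover have "radial_stretch a b u = (\<lambda>v. cmod b *\<^sub>R ?T v)"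
    using r by (simp add: scale_radial_stretch flip: mult.assoc)
  ultimately show ?thesis
    unfolding CO_form_def using r by fastforce
qed

section \<open>Classical derivatives as weak derivatives\<close>

lemma continuous_on_imp_Lp_loc:
  fixes f :: "'a::euclidean_space \<Rightarrow> 'b::euclidean_space"
  assumes "open \<Omega>" "continuous_on \<Omega> f"
  shows "f \<in> Lp_loc p \<Omega>"
proof -
  have "set_integrable lebesgue K (\<lambda>x. norm (f x) ^ p)" if "compact K" "K \<subseteq> \<Omega>" for K
  proof -
    have "integrable lborel (\<lambda>x. indicator K x *\<^sub>R norm (f x) ^ p)"
      using that assms(2) by (intro borel_integrable_compact continuous_intros) (auto intro: continuous_on_subset)
    then show ?thesis
      by (auto simp: set_integrable_def integrable_completion dest: borel_measurable_integrable)
  qed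
  moreover have "f \<in> borel_measurable (lebesgue_on \<Omega>)"
    using assms by (intro continuous_imp_measurable_on_sets_lebesgue) auto
  ultimately show ?thesis by (simp add: Lp_loc_def)
qed

text \<open>The open sets \<Omega> and \<open>- K\<close> cover the space, and the product is
  continuous on each. This allows \<open>f\<close> to take arbitrary values outside
  \<Omega>.\<close>

lemma continuous_on_scaleR_compact_support:
  fixes g :: "'a::euclidean_space \<Rightarrow> real" and f :: "'a \<Rightarrow> 'b::real_normed_vector"
  assumes "open \<Omega>" "continuous_on \<Omega> f" "continuous_on UNIV g"
    and "compact K" "K \<subseteq> \<Omega>" "\<And>x. x \<notin> K \<Longrightarrow> g x = 0"
  shows "continuous_on UNIV (\<lambda>x. g x *\<^sub>R f x)"
proof -
  have "continuous_on (- K) (\<lambda>x. g x *\<^sub>R f x) \<longleftrightarrow> continuous_on (- K) (\<lambda>_. 0 :: 'b)"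
    using assms(6) by (intro continuous_on_cong) auto
  moreover have "continuous_on \<Omega> (\<lambda>x. g x *\<^sub>R f x)"
    using assms(2,3) by (intro continuous_intros) (auto intro: continuous_on_subset)
  moreover have "open (- K)"
    using assms(4) by (simp add: compact_imp_closed open_Compl)
  ultimately have "continuous_on (\<Omega> \<union> - K) (\<lambda>x. g x *\<^sub>R f x)"
    using assms(1) by (intro continuous_on_open_Un) auto
  also have "\<Omega> \<union> - K = UNIV" using assms(5) by auto
  finally show ?thesis .
qed

lemma set_lebesgue_integral_eq_lborel:
  fixes f :: "'a::euclidean_space \<Rightarrow> 'b::euclidean_space"
  assumes "continuous_on UNIV f" "\<And>x. x \<notin> \<Omega> \<Longrightarrow> f x = 0"
  shows "(LINT x:\<Omega>|lebesgue. f x) = (LINT x|lborel. f x)"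
proof -
  have "(\<lambda>x. indicat_real \<Omega> x *\<^sub>R f x) = f"
    using assms(2) by (auto simp: indicator_def)
  then show ?thesis
    using borel_measurable_continuous_onI[OF assms(1)]
    by (simp add: set_lebesgue_integral_def integral_completion)
qed

text \<open>Integration by parts: for a test function \<open>g\<close>, the product
  \<open>g F\<close> has compact support, so the integral of each of its partial derivatives
  vanishes; the Leibniz rule splits that integral into the two required terms.\<close>

lemma C1_has_sobolev_derivative_on:
  fixes F :: "'a::euclidean_space \<Rightarrow> 'b::euclidean_space"
  assumes \<Omega>: "open \<Omega>"
    and F: "\<And>x. x \<in> \<Omega> \<Longrightarrow> (F has_derivative D x) (at x)"
    and D: "\<And>b. b \<in> Basis \<Longrightarrow> continuous_on \<Omega> (\<lambda>x. D x b)"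
  shows "has_sobolev_derivative_on p F D \<Omega>"
proof -
  have contF: "continuous_on \<Omega> F"
    using F by (meson continuous_at_imp_continuous_on has_derivative_continuous)
  have "(LINT x:\<Omega>|lebesgue. frechet_derivative g (at x) b *\<^sub>R F x) =
        - (LINT x:\<Omega>|lebesgue. g x *\<^sub>R D x b)"
    if g: "g \<in> test_functions \<Omega>" and b: "b \<in> Basis" for g b
  proof -
    define K where "K = closure {x. g x \<noteq> 0}"
    define g' where "g' x = frechet_derivative g (at x)" for x
    have K: "compact K" "K \<subseteq> \<Omega>"
      using g by (auto simp: test_functions_def K_def)
    have g0: "g x = 0" if "x \<notin> K" for x
      using that closure_subset[of "{x. g x \<noteq> 0}"] by (auto simp: K_def)
    have "times_cont_diff 1 g"
      using g by (simp only: test_functions_def mem_Collect_eq)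
    then have diff: "g differentiable (at x)" and contg': "continuous_on UNIV (\<lambda>x. g' x b)" for x
      using b by (simp_all add: g'_def)
    have g': "(g has_derivative g' x) (at x)" for x
      using diff frechet_derivative_works by (auto simp: g'_def)
    have contg: "continuous_on UNIV g"
      using g' by (meson continuous_at_imp_continuous_on has_derivative_continuous)
    have openK: "open (- K)" using K(1) by (simp add: compact_imp_closed open_Compl)
    have g'0: "g' x = (\<lambda>_. 0)" if "x \<notin> K" for x
    proof -
      have "((\<lambda>_. 0) has_derivative g' x) (at x)"
        using that g0 openK by (intro has_derivative_transform_within_open[OF g', of "- K"]) auto
      then show ?thesis by (rule has_derivative_unique) simp
    qed
    have cont1: "continuous_on UNIV (\<lambda>x. g' x b *\<^sub>R F x)"
      using g'0 by (intro continuous_on_scaleR_compact_support[OF \<Omega> contF contg' K]) auto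
    have cont2: "continuous_on UNIV (\<lambda>x. g x *\<^sub>R D x b)"
      using g0 by (intro continuous_on_scaleR_compact_support[OF \<Omega> D[OF b] contg K]) auto
    \<comment> \<open>The product rule holds at every point of the space: off \<open>K\<close> the
      product is locally zero, and both coefficients vanish whatever \<open>F\<close> and
      \<open>D\<close> are there.\<close>
    have "((\<lambda>x. g x *\<^sub>R F x) has_derivative (\<lambda>v. g' x v *\<^sub>R F x + g x *\<^sub>R D x v)) (at x)" for x
    proof (cases "x \<in> K")
      case True
      then have "x \<in> \<Omega>" using K(2) by auto
      from has_derivative_scaleR[OF g' F[OF this]] show ?thesis
        by (simp add: add.commute)
    next
      case False
      have "((\<lambda>x. g x *\<^sub>R F x) has_derivative (\<lambda>_. 0)) (at x)"
        using False g0
        by (intro has_derivative_transform_within_open[OF has_derivative_const openK]) auto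
      then show ?thesis using False by (simp add: g0 g'0)
    qed
    from integral_directional_derivative_eq_0[OF this, of b K]
    have "(LINT x|lborel. g' x b *\<^sub>R F x + g x *\<^sub>R D x b) = 0"
      using K(1) g0 continuous_on_add[OF cont1 cont2] by auto
    moreover have "integrable lborel (\<lambda>x. g' x b *\<^sub>R F x)" "integrable lborel (\<lambda>x. g x *\<^sub>R D x b)"
      using g0 g'0
      by (auto intro!: integrable_continuous_compact_support[OF cont1 K(1)] integrable_continuous_compact_support[OF cont2 K(1)])
    ultimately have "(LINT x|lborel. g' x b *\<^sub>R F x) = - (LINT x|lborel. g x *\<^sub>R D x b)"
      by (simp add: eq_neg_iff_add_eq_0)
    moreover have "g x = 0 \<and> g' x b = 0" if "x \<notin> \<Omega>" for x
    proof -
      have "x \<notin> K" using that K(2) by auto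
      then show ?thesis by (simp add: g0 g'0)
    qed
    ultimately show ?thesis
      using cont1 cont2 by (simp add: set_lebesgue_integral_eq_lborel flip: g'_def)
  qed
  then show ?thesis
    using F D \<Omega> contF
    by (auto simp: has_sobolev_derivative_on_def has_weak_derivative_on_def
        intro!: continuous_on_imp_Lp_loc dest: has_derivative_linear)
qed

section \<open>The profile function and conformality of the catenoid map\<close>

lemma profile_power:
  assumes "n > 0" "Im c \<noteq> 0"
  shows "profile n c t ^ n = complex_of_real (sinh (real n * t)) + c"
  using assms by (simp add: profile_def powr_def complex_eq_iff flip: exp_of_nat_mult)

text \<open>Since \<open>Im c \<noteq> 0\<close>, the base of the power avoids the branch cut, so
  the chain rule applies; the inner factor \<open>n\<close> cancels the exponent
  \<open>1 / n\<close>.\<close>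

lemma has_vector_derivative_profile:
  assumes "n > 0" "Im c \<noteq> 0"
  shows "(profile n c has_vector_derivative
    profile n c t * of_real (cosh (real n * t)) / (of_real (sinh (real n * t)) + c)) (at t)"
proof -
  let ?g = "\<lambda>t. complex_of_real (sinh (real n * t)) + c" and ?s = "1 / of_nat n :: complex"
  have nz: "?g t \<noteq> 0" "?g t \<notin> \<real>\<^sub>\<le>\<^sub>0"
    using assms(2) by (auto simp: complex_eq_iff complex_nonpos_Reals_iff)
  have "((\<lambda>t. sinh (real n * t)) has_real_derivative cosh (real n * t) * real n) (at t)"
    by (auto intro!: derivative_eq_intros)
  then have "((\<lambda>t. complex_of_real (sinh (real n * t))) has_vector_derivative of_real (cosh (real n * t) * real n)) (at t)"
    by (intro has_vector_derivative_of_real) (simp add: has_real_derivative_iff_has_vector_derivative)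
  then have "(?g has_vector_derivative of_real (cosh (real n * t) * real n)) (at t)"
    by (auto intro!: derivative_eq_intros)
  from field_vector_diff_chain_at[OF this has_field_derivative_powr[OF nz(2)], of ?s]
  have "((\<lambda>t. ?g t powr ?s) has_vector_derivative
      of_real (cosh (real n * t) * real n) * (?s * ?g t powr (?s - 1))) (at t)"
    by (simp add: o_def)
  moreover have "of_real (cosh (real n * t) * real n) * (?s * ?g t powr (?s - 1)) =
      ?g t powr ?s * of_real (cosh (real n * t)) / ?g t"
    using assms(1) nz(1) by (simp add: powr_diff)
  ultimately show ?thesis
    by (simp add: profile_def[abs_def])
qed

lemma cmod_sinh_add:
  assumes "Re c = 0" "cmod c = 1"
  shows "cmod (complex_of_real (sinh s) + c) = cosh s"
proof -
  have "(Im c)\<^sup>2 = 1"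
    using assms by (simp add: cmod_def power2_eq_1_iff abs_if split: if_splits)
  then have "(cmod (complex_of_real (sinh s) + c))\<^sup>2 = (cosh s)\<^sup>2"
    using assms(1) by (simp add: cmod_power2 cosh_square_eq)
  then show ?thesis by (simp add: power2_eq_iff_nonneg)
qed

lemma catenoid_map_eq:
  fixes x :: "real^'n"
  shows "catenoid_map c x = ((Re (profile CARD('n) c (ln (norm x))) / norm x) *\<^sub>R x,
    (Im (profile CARD('n) c (ln (norm x))) / norm x) *\<^sub>R x)"
  by (simp add: catenoid_map_def cylinder_map_def log_polar_def cscale_def iota_def)
    (simp add: divide_inverse)

text \<open>The map is \<open>q(|x|) x\<close> with \<open>q r = f (ln r) / r\<close>, and \<phi> is
  the logarithmic derivative \<open>f' / f\<close>. The derivative sends \<open>v\<close> to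
  \<open>q v + q' (u \<bullet> v) x\<close>, so the radial factor is
  \<open>q + r q' = f \<phi> / r\<close> and the tangential one is \<open>q = f / r\<close>.\<close>

lemma catenoid_map_derivative:
  fixes x :: "real^'n"
  assumes "x \<noteq> 0" "Im c \<noteq> 0"
  defines "f \<equiv> profile CARD('n) c (ln (norm x))"
    and "\<phi> \<equiv> of_real (cosh (real CARD('n) * ln (norm x))) / (of_real (sinh (real CARD('n) * ln (norm x))) + c)"
  shows "(catenoid_map c has_derivative
    radial_stretch (f * (\<phi> - 1) / of_real (norm x)) (f / of_real (norm x)) (x /\<^sub>R norm x)) (at x)"
proof -
  let ?q = "\<lambda>r. profile CARD('n) c (ln r) / of_real r"
  let ?r = "norm x"
  \<comment> \<open>The quotient rule: \<open>f \<phi> / r^2\<close> from the numerator, where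
    \<open>ln\<close> contributes one factor \<open>1 / r\<close>, minus
    \<open>f / r^2\<close>.\<close>
  let ?q' = "f * (\<phi> - 1) / (of_real ?r * of_real ?r)"
  have r: "?r > 0" using assms(1) by simp
  have "(ln has_vector_derivative inverse ?r) (at ?r)"
    using r by (auto intro!: derivative_eq_intros simp: divide_inverse simp flip: has_real_derivative_iff_has_vector_derivative)
  from vector_diff_chain_at[OF this has_vector_derivative_profile[OF _ assms(2), of "CARD('n)"]]
  have 1: "((\<lambda>r. profile CARD('n) c (ln r)) has_vector_derivative inverse ?r *\<^sub>R (f * \<phi>)) (at ?r)"
    by (simp add: o_def f_def \<phi>_def)
  have "((\<lambda>r. inverse r) has_real_derivative - inverse (?r * ?r)) (at ?r)"
    using r by (auto intro!: derivative_eq_intros)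
  then have 2: "((\<lambda>r. complex_of_real (inverse r)) has_vector_derivative of_real (- inverse (?r * ?r))) (at ?r)"
    by (intro has_vector_derivative_of_real) (simp add: has_real_derivative_iff_has_vector_derivative)
  have q: "(?q has_vector_derivative ?q') (at ?r)"
    using has_vector_derivative_mult[OF 1 2] r
    by (simp add: divide_inverse f_def[symmetric] scaleR_conv_of_real algebra_simps)
  have "((\<lambda>y. ?q (norm y)) has_derivative (\<lambda>v. (v \<bullet> sgn x) *\<^sub>R ?q')) (at x)"
    using has_derivative_compose[OF has_derivative_norm[OF assms(1)], of ?q "\<lambda>t. t *\<^sub>R ?q'"] q
    by (simp add: has_vector_derivative_def)
  note Q = this bounded_linear.has_derivative[OF bounded_linear_Re this] bounded_linear.has_derivative[OF bounded_linear_Im this]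
  have "((\<lambda>y. (Re (?q (norm y)) *\<^sub>R y, Im (?q (norm y)) *\<^sub>R y)) has_derivative
     (\<lambda>v. (Re (?q ?r) *\<^sub>R v + ((v \<bullet> sgn x) * Re ?q') *\<^sub>R x, Im (?q ?r) *\<^sub>R v + ((v \<bullet> sgn x) * Im ?q') *\<^sub>R x))) (at x)"
    using has_derivative_Pair[OF has_derivative_scaleR[OF Q(2) has_derivative_ident] has_derivative_scaleR[OF Q(3) has_derivative_ident]]
    by simp
  moreover have "(\<lambda>y :: real^'n. (Re (?q (norm y)) *\<^sub>R y, Im (?q (norm y)) *\<^sub>R y)) = catenoid_map c"
    by (simp add: fun_eq_iff catenoid_map_eq)
  moreover have "(\<lambda>v. (Re (?q ?r) *\<^sub>R v + ((v \<bullet> sgn x) * Re ?q') *\<^sub>R x, Im (?q ?r) *\<^sub>R v + ((v \<bullet> sgn x) * Im ?q') *\<^sub>R x)) =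
     radial_stretch (f * (\<phi> - 1) / of_real ?r) (f / of_real ?r) (x /\<^sub>R ?r)"
    using r
    by (auto simp: radial_stretch_def cscale_def iota_def sgn_div_norm f_def[symmetric] inner_commute
        Re_divide_of_real Im_divide_of_real divide_inverse algebra_simps simp flip: of_real_mult of_real_inverse)
  ultimately show ?thesis by simp
qed

lemma conformal_curve_catenoid_map:
  assumes "Re c = 0" "cmod c = 1"
  shows "conformal_curve omega_SL (UNIV - {0}) (catenoid_map c :: real^'n \<Rightarrow> (real^'n) \<times> (real^'n))"
proof -
  let ?n = "CARD('n)"
  have c: "Im c \<noteq> 0" using assms by (auto simp: cmod_def)
  define f where "f x = profile ?n c (ln (norm x))" for x :: "real^'n"
  define z where "z x = complex_of_real (sinh (real ?n * ln (norm x))) + c" for x :: "real^'n"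
  define \<phi> where "\<phi> x = of_real (cosh (real ?n * ln (norm x))) / z x" for x :: "real^'n"
  define D where "D x = radial_stretch (f x * (\<phi> x - 1) / of_real (norm x)) (f x / of_real (norm x)) (x /\<^sub>R norm x)"
    for x :: "real^'n"
  have z0: "z x \<noteq> 0" for x
    using c by (auto simp: z_def complex_eq_iff)
  have zn: "cmod (z x) = cosh (real ?n * ln (norm x))" for x
    by (simp add: z_def cmod_sinh_add assms)
  have fn: "f x ^ ?n = z x" for x
    by (simp add: f_def z_def profile_power c)
  then have f0: "f x \<noteq> 0" for x
    using z0[of x] by (metis power_0_left zero_less_card_finite less_irrefl)
  have \<phi>1: "cmod (\<phi> x) = 1" for x
    by (simp add: \<phi>_def norm_divide zn)
  have "continuous_on UNIV (profile ?n c)"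
    using has_vector_derivative_profile[OF _ c] zero_less_card_finite
    by (meson continuous_at_imp_continuous_on has_vector_derivative_continuous)
  then have contf: "continuous_on (UNIV - {0}) f"
    unfolding f_def by (rule continuous_on_compose2) (auto intro!: continuous_intros)
  have "continuous_on (UNIV - {0}) z"
    unfolding z_def by (auto intro!: continuous_intros)
  then have cont\<phi>: "continuous_on (UNIV - {0}) \<phi>"
    unfolding \<phi>_def using z0 by (auto intro!: continuous_intros)
  have "has_sobolev_derivative_on ?n (catenoid_map c) D (UNIV - {0})"
  proof (rule C1_has_sobolev_derivative_on)
    show "(catenoid_map c has_derivative D x) (at x)" if "x \<in> UNIV - {0}" for x
      using catenoid_map_derivative[OF _ c, of x] that
      by (simp add: D_def f_def \<phi>_def z_def)
    show "continuous_on (UNIV - {0}) (\<lambda>x. D x b)" for b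
      unfolding D_def radial_stretch_def cscale_def iota_def fst_conv snd_conv
      by (intro continuous_intros contf cont\<phi>) auto
  qed auto
  moreover have "D x \<in> CO_form omega_SL" if "x \<noteq> 0" for x
    unfolding D_def
  proof (rule radial_stretch_in_CO)
    let ?a = "f x * (\<phi> x - 1) / of_real (norm x)" and ?b = "f x / of_real (norm x)"
    have ab: "?a + ?b = ?b * \<phi> x"
      by (simp add: algebra_simps add_divide_distrib diff_divide_distrib)
    show "norm (x /\<^sub>R norm x) = 1" "?b \<noteq> 0"
      using that f0 by auto
    show "cmod (?a + ?b) = cmod ?b"
      unfolding ab by (simp add: norm_mult norm_divide \<phi>1)
    have "(?a + ?b) * ?b ^ (?n - 1) = \<phi> x * ?b ^ ?n"
      unfolding ab by (simp only: power_minus_mult[OF zero_less_card_finite, symmetric] mult_ac)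
    \<comment> \<open>Here \<open>f^n = z\<close> cancels the denominator of \<phi>, leaving the
      positive number \<open>cosh (n ln |x|) = |z| = |f|^n\<close> over
      \<open>|x|^n\<close>.\<close>
    also have "\<dots> = of_real (cmod ?b ^ ?n)"
      using z0[of x] by (simp add: power_divide norm_divide fn zn \<phi>_def flip: norm_power)
    finally show "(?a + ?b) * ?b ^ (?n - 1) = of_real (cmod ?b ^ ?n)" .
  qed
  ultimately show ?thesis
    unfolding conformal_curve_def by (auto intro!: exI[of _ D] AE_I2)
qed

section \<open>The image: roots, sectors and the catenoid\<close>

text \<open>The argument of \<open>z\<close> lies strictly between 0 and \<pi>, so that of the
  principal root lies strictly between 0 and \<open>\<pi> / n\<close>. For \<open>n > 2\<close> this
  range stays below \<open>\<pi> / 2\<close>, where the tangent is increasing, and the angle bound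
  becomes the stated inequality.\<close>

lemma root_in_sector:
  assumes "n \<ge> 2" "Im z > 0"
  shows "0 < Re (z powr (1 / of_nat n))" "0 < Im (z powr (1 / of_nat n))"
    and "n > 2 \<Longrightarrow> Im (z powr (1 / of_nat n)) < Re (z powr (1 / of_nat n)) * tan (pi / real n)"
proof -
  let ?w = "z powr (1 / of_nat n)"
  define \<theta> where "\<theta> = Im (Ln z) / real n"
  have \<theta>: "0 < \<theta>" "\<theta> < pi / real n"
    using Im_Ln_pos_lt_imp[OF assms(2)] assms(1) by (auto simp: \<theta>_def divide_strict_right_mono)
  have "pi / real n \<le> pi / 2"
    using assms(1) by (intro divide_left_mono) auto
  with \<theta> have \<theta>2: "\<theta> < pi / 2" by linarith
  have "z \<noteq> 0" using assms(2) by auto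
  then have w: "Re ?w = exp (Re (Ln z) / real n) * cos \<theta>" "Im ?w = exp (Re (Ln z) / real n) * sin \<theta>"
    by (simp_all add: powr_def Re_exp Im_exp \<theta>_def)
  have cos: "cos \<theta> > 0" using \<theta> \<theta>2 by (intro cos_gt_zero_pi) auto
  have sin: "sin \<theta> > 0" using \<theta> \<theta>2 by (intro sin_gt_zero) auto
  show "0 < Re ?w" "0 < Im ?w" using w cos sin by simp_all
  show "Im ?w < Re ?w * tan (pi / real n)" if "n > 2"
  proof -
    have "pi / real n < pi / 2" using that by (intro divide_strict_left_mono) auto
    then have "tan \<theta> < tan (pi / real n)"
      using \<theta> by (intro tan_monotone) (auto intro: less_trans[of _ 0])
    then have "sin \<theta> < cos \<theta> * tan (pi / real n)"
      unfolding tan_def using cos by (simp add: field_simps)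
    then show ?thesis by (simp add: w)
  qed
qed

text \<open>The argument of \<open>w\<close> is at most \<open>\<pi> / n\<close>, so
  \<open>n Ln w\<close> lies in the strip of the principal logarithm and equals
  \<open>Ln (w^n)\<close>.\<close>

lemma root_of_power_in_sector:
  assumes "n \<ge> 2" "0 < Re w" "0 < Im w"
    and "n > 2 \<Longrightarrow> Im w < Re w * tan (pi / real n)"
  shows "(w ^ n) powr (1 / of_nat n) = w"
proof -
  have w0: "w \<noteq> 0" using assms(2) by auto
  define \<theta> where "\<theta> = Im (Ln w)"
  have \<theta>: "0 < \<theta>" "\<theta> < pi / 2"
    using Re_Ln_pos_lt_imp[OF assms(2)] Im_Ln_pos_lt_imp[OF assms(3)] by (auto simp: \<theta>_def)
  \<comment> \<open>The weak bound suffices, as the strip of \<open>Ln\<close> includes imaginary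
    part \<pi>. For \<open>n = 2\<close> it is the bound \<open>\<theta> < \<pi> / 2\<close> of the
    right half plane.\<close>
  have "\<theta> \<le> pi / real n"
  proof (cases "n = 2")
    case False
    then have n: "n > 2" using assms(1) by simp
    have "w = exp (Ln w)" using w0 by simp
    then have "Im w / Re w = tan \<theta>"
      unfolding tan_def \<theta>_def by (metis Im_exp Re_exp exp_not_eq_zero mult_divide_mult_cancel_left)
    then have "tan \<theta> < tan (pi / real n)"
      using assms(2) assms(4)[OF n] by (simp add: field_simps flip: \<open>Im w / Re w = tan \<theta>\<close>)
    moreover have "tan (pi / real n) < tan \<theta>" if "pi / real n < \<theta>"
      using that \<theta> assms(1) by (intro tan_monotone) (auto intro: less_trans[of _ 0])
    ultimately show ?thesis by force
  qed (use \<theta> in simp)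
  then have "real n * \<theta> \<le> pi"
    using assms(1) by (simp add: field_simps)
  moreover have "- pi < real n * \<theta>"
    using \<theta> assms(1) pi_gt_zero by (smt (verit) mult_nonneg_nonneg of_nat_0_le_iff)
  moreover have "exp (of_nat n * Ln w) = w ^ n"
    using w0 by (simp add: exp_of_nat_mult)
  ultimately have "Ln (w ^ n) = of_nat n * Ln w"
    by (intro Ln_unique) (auto simp: \<theta>_def)
  then show ?thesis
    using w0 assms(1) by (simp add: powr_def)
qed

lemma image_catenoid_map:
  assumes "CARD('n::finite) \<ge> 2"
  shows "catenoid_map \<i> ` (UNIV - {0 :: real^'n}) = catenoid_SL"
proof (intro subset_antisym subsetI)
  let ?n = "CARD('n)"
  fix y :: "(real^'n) \<times> (real^'n)"
  assume "y \<in> catenoid_map \<i> ` (UNIV - {0})"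
  then obtain x where x: "x \<noteq> 0" "y = catenoid_map \<i> x" by auto
  define w where "w = profile ?n \<i> (ln (norm x))"
  have y: "y = ((Re w / norm x) *\<^sub>R x, (Im w / norm x) *\<^sub>R x)"
    by (simp add: x(2) catenoid_map_eq w_def)
  have w: "0 < Re w" "0 < Im w" "?n > 2 \<Longrightarrow> Im w < Re w * tan (pi / real ?n)"
    unfolding w_def profile_def by (auto intro!: root_in_sector assms)
  have "w ^ ?n = of_real (sinh (real ?n * ln (norm x))) + \<i>"
    unfolding w_def by (simp add: profile_power)
  then have "Im (w ^ ?n) = 1" by simp
  then show "y \<in> catenoid_SL"
    using w x(1) by (simp add: y catenoid_SL_def complex_surj)
next
  let ?n = "CARD('n)"
  fix y :: "(real^'n) \<times> (real^'n)"
  assume "y \<in> catenoid_SL"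
  then obtain p q where y: "y = (p, q)" and pq: "norm p *\<^sub>R q = norm q *\<^sub>R p"
    and im: "Im (Complex (norm p) (norm q) ^ ?n) = 1"
    and tan: "?n > 2 \<Longrightarrow> norm q < norm p * tan (pi / real ?n)"
    by (auto simp: catenoid_SL_def)
  define w where "w = Complex (norm p) (norm q)"
  have "q \<noteq> 0"
  proof
    assume "q = 0"
    then have "Complex (norm p) (norm q) = of_real (norm p)" by (simp add: complex_eq_iff)
    then show False using im by (simp flip: of_real_power)
  qed
  \<comment> \<open>With \<open>p = 0\<close> the tangent bound for \<open>n > 2\<close> would read
    \<open>|q| < 0\<close>; for \<open>n = 2\<close> the square of an imaginary number is real,
    contradicting \<open>im\<close>.\<close>
  have "p \<noteq> 0"
  proof
    assume p: "p = 0"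
    then have "?n = 2" using tan assms norm_ge_zero[of q] by force
    then show False using im p by (simp add: power2_eq_square)
  qed
  \<comment> \<open>Chosen so that \<open>sinh (n t)\<close> is the real part of \<open>w^n\<close>,
    whose imaginary part is already 1.\<close>
  define t where "t = arsinh (Re (w ^ ?n)) / real ?n"
  have "sinh (real ?n * t) = Re (w ^ ?n)"
    by (simp add: t_def)
  then have "of_real (sinh (real ?n * t)) + \<i> = w ^ ?n"
    using im by (simp add: w_def complex_eq_iff)
  then have "profile ?n \<i> t = (w ^ ?n) powr (1 / of_nat ?n)"
    by (simp add: profile_def)
  also have "\<dots> = w"
    using \<open>p \<noteq> 0\<close> \<open>q \<noteq> 0\<close> tan assms by (intro root_of_power_in_sector) (auto simp: w_def)
  finally have w: "profile ?n \<i> t = w" .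
  \<comment> \<open>The point with \<open>log_polar x = (t, p / |p|)\<close>.\<close>
  define x where "x = exp t *\<^sub>R (p /\<^sub>R norm p)"
  have nx: "norm x = exp t" using \<open>p \<noteq> 0\<close> by (simp add: x_def)
  have "q = (norm q / norm p) *\<^sub>R p"
    using arg_cong[OF pq, of "\<lambda>v. v /\<^sub>R norm p"] \<open>p \<noteq> 0\<close> by (simp add: divide_inverse mult.commute)
  moreover have "(norm q / exp t) *\<^sub>R x = (norm q / norm p) *\<^sub>R p" "(norm p / exp t) *\<^sub>R x = p"
    using \<open>p \<noteq> 0\<close> by (simp_all add: x_def) (simp add: divide_inverse)
  ultimately have "catenoid_map \<i> x = y"
    by (simp add: catenoid_map_eq nx w y w_def)
  moreover have "x \<noteq> 0" using nx by auto
  ultimately show "y \<in> catenoid_map \<i> ` (UNIV - {0})" by auto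
qed

text \<open>Principal powers commute with conjugation off the branch cut, which
  \<open>Im c \<noteq> 0\<close> keeps away from the base.\<close>

lemma catenoid_map_cnj:
  assumes "Im c \<noteq> 0"
  shows "catenoid_map (cnj c) x = conj_vec (catenoid_map c x)"
proof -
  have "profile n (cnj c) t = cnj (profile n c t)" for n t
    unfolding profile_def using assms by (subst cnj_powr) auto
  then show ?thesis
    by (simp add: catenoid_map_eq conj_vec_def)
qed

text \<open>With \<open>- \<i>\<close> as in the English formula, \<open>f^n\<close> has imaginary
  part -1 and the image is the complex conjugate of the catenoid as defined; with
  \<open>\<i>\<close> it is the catenoid itself. Both signs are therefore stated.\<close>

theorem proposition1p5:
  assumes "CARD('n::finite) \<ge> 2"
  shows "conformal_curve omega_SL (UNIV - {0}) (catenoid_map \<i> :: real^'n \<Rightarrow> (real^'n) \<times> (real^'n)) \<and>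
         catenoid_map \<i> ` (UNIV - {0 :: real^'n}) = catenoid_SL \<and>
         conformal_curve omega_SL (UNIV - {0}) (catenoid_map (- \<i>) :: real^'n \<Rightarrow> (real^'n) \<times> (real^'n)) \<and>
         catenoid_map (- \<i>) ` (UNIV - {0 :: real^'n}) = conj_vec ` catenoid_SL"
proof -
  have "catenoid_map (- \<i>) = conj_vec \<circ> (catenoid_map \<i> :: real^'n \<Rightarrow> _)"
    by (rule ext) (simp add: catenoid_map_cnj[of \<i>, simplified])
  then have "catenoid_map (- \<i>) ` (UNIV - {0 :: real^'n}) = conj_vec ` catenoid_map \<i> ` (UNIV - {0})"
    by (simp add: image_comp)
  then show ?thesis
    using image_catenoid_map[OF assms] by (simp add: conformal_curve_catenoid_map)
qed

end
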